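(* Let $G$ be a double wheel with principal path $\overrightarrow{v_kv_1v_2}$ and components $G_1,G_2$, neither of which is an even wheel, where $v_3,\dots,v_{k-1}$ are the remaining vertices on the outer cycle of $G$ and $u_1,\dots,u_m$ are the vertices of $G$ not on the outer cycle. Then every monomial $v_1^0v_2^0v_k^0\prod_{i=3}^{k-1}v_i^{\alpha_i}\prod_{j=1}^m u_j^{\beta_j}$ with $\alpha_i\le2$ and $\beta_j\le4$ vanishes in $P(G-\overrightarrow{v_kv_1v_2})$.
   Context: For a graph $G$, vertices are also variables and $P(G)=\prod_{uv\in E(G),\,u<v}(u-v)$ for a fixed arbitrary orientation; a monomial vanishes if its coefficient is zero. $G-\overrightarrow{v_kv_1v_2}$ is $G$ with edges $v_kv_1,v_1v_2$ deleted (vertices kept). An ordinary wheel consists of a cycle $v_1\dots v_kv_1$ ($k\ge3$) and a vertex adjacent to all $v_i$; it is even if $k$ is even. A broken wheel consists of a path $v_2\dots v_k$ ($k\ge3$) and a vertex $v_1$ adjacent to all of $v_2,\dots,v_k$. For both, $\overrightarrow{v_kv_1v_2}$ is the principal path, $v_kv_1,v_1v_2$ the principal edges, $v_1,v_2,v_k$ the principal vertices. A double wheel is obtained from two graphs $G_1,G_2$ (its components), each an ordinary or broken wheel, at least one of them ordinary, by identifying their vertices $v_1$ and identifying a principal edge of $G_1$ with a principal edge of $G_2$ (the two pieces on opposite sides of the identified edge in the plane); in the result the common vertex is $v_1$, the two non-identified principal vertices are $v_2,v_k$, and $\overrightarrow{v_kv_1v_2}$ is the principal path. *)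

theory Defs
  imports Main "HOL-Library.Poly_Mapping"
begin

section \<open>Simple graphs\<close>

record 'v graph =
  verts :: "'v set"
  edges :: "'v set set"

definition graph_union :: "'v graph \<Rightarrow> 'v graph \<Rightarrow> 'v graph" where
  "graph_union G H = \<lparr>verts = verts G \<union> verts H, edges = edges G \<union> edges H\<rparr>"

definition delete_edges :: "'v graph \<Rightarrow> 'v set set \<Rightarrow> 'v graph" where
  "delete_edges G F = \<lparr>verts = verts G, edges = edges G - F\<rparr>"

fun path_edges :: "'v list \<Rightarrow> 'v set set" where
  "path_edges (x # y # xs) = insert {x, y} (path_edges (y # xs))"
| "path_edges _ = {}"

definition cycle_edges :: "'v list \<Rightarrow> 'v set set" where
  "cycle_edges cs = insert {last cs, hd cs} (path_edges cs)"


section \<open>Wheels\<close>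

text \<open>Throughout, the outer cycle is given as the list \<open>[v\<^sub>1, \<dots>, v\<^sub>k]\<close>, so that the
  principal path \<open>v\<^sub>k v\<^sub>1 v\<^sub>2\<close> is \<open>last cs, hd cs, cs ! 1\<close>.\<close>

definition ordinary_wheel :: "'v graph \<Rightarrow> 'v list \<Rightarrow> bool" where
  "ordinary_wheel G cs \<longleftrightarrow> distinct cs \<and> length cs \<ge> 3 \<and>
     (\<exists>u. u \<notin> set cs \<and>
        G = \<lparr>verts = insert u (set cs), edges = cycle_edges cs \<union> (\<lambda>x. {u, x}) ` set cs\<rparr>)"

definition even_wheel :: "'v graph \<Rightarrow> bool" where
  "even_wheel G \<longleftrightarrow> (\<exists>cs. ordinary_wheel G cs \<and> even (length cs))"

definition broken_wheel :: "'v graph \<Rightarrow> 'v list \<Rightarrow> bool" where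
  "broken_wheel G cs \<longleftrightarrow> distinct cs \<and> length cs \<ge> 3 \<and>
     G = \<lparr>verts = set cs, edges = path_edges (tl cs) \<union> (\<lambda>x. {hd cs, x}) ` set (tl cs)\<rparr>"

definition principal_edges :: "'v list \<Rightarrow> 'v set set" where
  "principal_edges cs = {{last cs, hd cs}, {hd cs, cs ! 1}}"

text \<open>Identification is expressed inside the resulting graph: \<open>G\<close> is the union of \<open>G1\<close> and
  \<open>G2\<close>, which share exactly the two ends \<open>v1\<close>, \<open>w\<close> of the identified principal edge. As the
  two pieces lie on opposite sides of that edge, the outer cycle of \<open>G\<close> is the outer cycle
  \<open>v1 # xs @ [w]\<close> of \<open>G1\<close> followed by the rest of the outer cycle \<open>v1 # w # ys\<close> of \<open>G2\<close>.
  That \<open>w\<close> is the last vertex on the first cycle and the second one on the other is no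
  restriction, since wheels can be reflected (\<open>ordinary_wheel_reflect\<close>,
  \<open>broken_wheel_reflect\<close> below); nor is the choice of the side containing \<open>v\<^sub>2\<close>
  (\<open>double_wheel_reflect\<close>).\<close>

definition double_wheel :: "'v graph \<Rightarrow> 'v graph \<Rightarrow> 'v graph \<Rightarrow> 'v list \<Rightarrow> bool" where
  "double_wheel G G1 G2 vs \<longleftrightarrow>
     (\<exists>v1 xs w ys.
        vs = v1 # xs @ w # ys \<and>
        (ordinary_wheel G1 (v1 # xs @ [w]) \<or> broken_wheel G1 (v1 # xs @ [w])) \<and>
        (ordinary_wheel G2 (v1 # w # ys) \<or> broken_wheel G2 (v1 # w # ys)) \<and>
        (ordinary_wheel G1 (v1 # xs @ [w]) \<or> ordinary_wheel G2 (v1 # w # ys)) \<and>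
        verts G1 \<inter> verts G2 = {v1, w} \<and>
        G = graph_union G1 G2)"

lemma path_edges_append:
  "path_edges (xs @ x # y # ys) = insert {x, y} (path_edges (xs @ [x]) \<union> path_edges (y # ys))"
proof (induction xs)
  case (Cons a xs)
  then show ?case by (cases xs) auto
qed simp

lemma path_edges_rev: "path_edges (rev xs) = path_edges xs"
proof (induction xs rule: path_edges.induct)
  case (1 x y xs)
  then show ?case
    using path_edges_append[of "rev xs" y x "[]"] by (simp add: insert_commute)
qed simp_all

lemma cycle_edges_reflect:
  assumes "xs \<noteq> []"
  shows "cycle_edges (x # rev xs) = cycle_edges (x # xs)"
proof -
  obtain y ys where xs: "xs = y # ys" using assms by (cases xs) auto
  have Cons: "path_edges (x # zs) = insert {x, hd zs} (path_edges zs)" if "zs \<noteq> []" for zs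
    using that by (cases zs) auto
  show ?thesis
    using assms path_edges_rev[of xs] Cons[of xs] Cons[of "rev xs"]
    by (auto simp: cycle_edges_def hd_rev last_rev insert_commute)
qed

lemma ordinary_wheel_reflect:
  assumes "ordinary_wheel G (x # xs)"
  shows "ordinary_wheel G (x # rev xs)"
proof -
  have "xs \<noteq> []" using assms by (auto simp: ordinary_wheel_def)
  then show ?thesis
    using assms cycle_edges_reflect[of xs x] by (simp add: ordinary_wheel_def)
qed

lemma broken_wheel_reflect:
  "broken_wheel G (x # xs) \<Longrightarrow> broken_wheel G (x # rev xs)"
  by (simp add: broken_wheel_def path_edges_rev)

lemma double_wheel_reflect:
  assumes "double_wheel G G1 G2 (x # xs)"
  shows "double_wheel G G2 G1 (x # rev xs)"
proof -
  obtain ps w ys where xs: "xs = ps @ w # ys"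
    and 1: "ordinary_wheel G1 (x # ps @ [w]) \<or> broken_wheel G1 (x # ps @ [w])"
    and 2: "ordinary_wheel G2 (x # w # ys) \<or> broken_wheel G2 (x # w # ys)"
    and 3: "ordinary_wheel G1 (x # ps @ [w]) \<or> ordinary_wheel G2 (x # w # ys)"
    and 4: "verts G1 \<inter> verts G2 = {x, w}" "G = graph_union G1 G2"
    using assms unfolding double_wheel_def by auto
  note r = ordinary_wheel_reflect[of G1 x "ps @ [w]"] broken_wheel_reflect[of G1 x "ps @ [w]"]
    ordinary_wheel_reflect[of G2 x "w # ys"] broken_wheel_reflect[of G2 x "w # ys"]
  show ?thesis
    unfolding double_wheel_def
    by (rule exI[of _ x], rule exI[of _ "rev ys"], rule exI[of _ w], rule exI[of _ "rev ps"])
      (use 1 2 3 4 r in \<open>auto simp: xs graph_union_def\<close>)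
qed


section \<open>Graph polynomials\<close>

text \<open>A monomial is its finitely supported exponent function, and a polynomial is the finitely
  supported function giving the coefficient of each monomial; the multiplication of
  \<open>Poly_Mapping\<close> (convolution) is then multiplication in \<open>\<int>[V]\<close>, the vertices being
  the variables.\<close>

type_synonym 'v monomial = "'v \<Rightarrow>\<^sub>0 nat"
type_synonym 'v polynomial = "'v monomial \<Rightarrow>\<^sub>0 int"

definition Var :: "'v \<Rightarrow> 'v polynomial" where
  "Var v = Poly_Mapping.single (Poly_Mapping.single v 1) 1"

definition orientation :: "'v graph \<Rightarrow> ('v \<times> 'v) set \<Rightarrow> bool" where
  "orientation G D \<longleftrightarrow>
     (\<forall>u v. {u, v} \<in> edges G \<longleftrightarrow> (u, v) \<in> D \<or> (v, u) \<in> D) \<and>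
     (\<forall>u v. (u, v) \<in> D \<longrightarrow> (v, u) \<notin> D)"

text \<open>\<open>D\<close> is the chosen orientation of the graph: \<open>(u, v) \<in> D\<close> plays the role of
  \<open>uv \<in> E(G), u < v\<close>.\<close>

definition graph_poly :: "('v \<times> 'v) set \<Rightarrow> 'v polynomial" where
  "graph_poly D = (\<Prod>(u, v)\<in>D. Var u - Var v)"

definition vanishes_in :: "'v monomial \<Rightarrow> 'v polynomial \<Rightarrow> bool" where
  "vanishes_in \<mu> p \<longleftrightarrow> Poly_Mapping.lookup p \<mu> = 0"

end

(* Let w be the outer vertex shared by the two components. Deleting the principal edges and the
   edge v1 w splits the edges of G into the two components, so that the graph polynomial is, up
   to sign, (w - v1) P1 P2. The monomial has v1-exponent 0, so the first factor contributes w;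
   as the w-exponent is at most 2, it remains to see that in each P_i a monomial obeying the
   exponent bounds vanishes if its w-exponent is 0.

   Both kinds of components reduce to a fan: a path from x to w together with the edges from a
   hub u to the inner vertices of the path. For a broken wheel, the hub v1 has exponent 0. For an
   ordinary wheel, the three edges from the hub to v1, x, w (all of exponent 0) contribute u^3, and
   u^1 is left for the fan. Write f(e, d) for the coefficient of x^e u^d times the squares of the
   inner vertices in a fan, and f' for the fan that starts one vertex later. The factors
   (x - y)(u - y) of the first inner vertex y give f(0,0) = f'(0,0), f(0,1) = f'(0,1) - f'(1,0)
   and f(1,0) = - f'(1,0). Hence f(0,0) = 0, and f(0,1) repeats after two steps, so that it is 0
   when the number of inner vertices is even, i.e. when the wheel is odd. *)

theory Submission
  imports Defs
begin

section \<open>Graph polynomials as products over edge lists\<close>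

abbreviation upair :: "'v \<times> 'v \<Rightarrow> 'v set" where
  "upair e \<equiv> {fst e, snd e}"

text \<open>A list lets edge factors be peeled off one at a time, with each edge oriented as is
  convenient.\<close>

definition edge_list_poly :: "('v \<times> 'v) list \<Rightarrow> 'v polynomial" where
  "edge_list_poly es = (\<Prod>(a, b)\<leftarrow>es. Var a - Var b)"

lemma edge_list_poly_Nil [simp]: "edge_list_poly [] = 1"
  by (simp add: edge_list_poly_def)

lemma edge_list_poly_Cons [simp]:
  "edge_list_poly ((a, b) # es) = (Var a - Var b) * edge_list_poly es"
  by (simp add: edge_list_poly_def)

lemma edge_list_poly_append:
  "edge_list_poly (es @ fs) = edge_list_poly es * edge_list_poly fs"
  by (simp add: edge_list_poly_def)

text \<open>Subtraction of monomials truncates at 0, so the case where \<open>a\<close> does not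
  divide the monomial has to be separated.\<close>

lemma lookup_Var_mult:
  "Poly_Mapping.lookup (Var a * p) \<mu> =
     (if Poly_Mapping.lookup \<mu> a = 0 then 0
      else Poly_Mapping.lookup p (\<mu> - Poly_Mapping.single a 1))"
proof -
  let ?s = "Poly_Mapping.single a (1::nat)"
  have "Poly_Mapping.lookup (Var a * p) \<mu> =
      (\<Sum>\<beta>. Poly_Mapping.lookup p \<beta> when \<mu> = ?s + \<beta>)"
    by (simp only: Var_def lookup_mult lookup_single when_mult) simp
  also have "\<dots> = (if Poly_Mapping.lookup \<mu> a = 0 then 0 else Poly_Mapping.lookup p (\<mu> - ?s))"
  proof (cases "Poly_Mapping.lookup \<mu> a = 0")
    case True
    then have "\<mu> \<noteq> ?s + \<beta>" for \<beta>
      by (metis add_is_0 lookup_add lookup_single_eq one_neq_zero)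
    then show ?thesis using True by simp
  next
    case False
    then have "\<mu> = ?s + \<beta> \<longleftrightarrow> \<beta> = \<mu> - ?s" for \<beta>
      by (auto simp: poly_mapping_eq_iff fun_eq_iff lookup_add lookup_minus lookup_single when_def)
    then show ?thesis using False by simp
  qed
  finally show ?thesis .
qed

lemma lookup_edge_mult:
  "Poly_Mapping.lookup ((Var a - Var b) * p) \<mu> =
     (if Poly_Mapping.lookup \<mu> a = 0 then 0
      else Poly_Mapping.lookup p (\<mu> - Poly_Mapping.single a 1)) -
     (if Poly_Mapping.lookup \<mu> b = 0 then 0
      else Poly_Mapping.lookup p (\<mu> - Poly_Mapping.single b 1))"
  by (simp add: left_diff_distrib lookup_minus lookup_Var_mult)

lemma lookup_edge_list_poly_eq_0:
  assumes "v \<notin> \<Union> (upair ` set es)" "Poly_Mapping.lookup \<mu> v \<noteq> 0"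
  shows "Poly_Mapping.lookup (edge_list_poly es) \<mu> = 0"
  using assms
proof (induction es arbitrary: \<mu>)
  case Nil
  then have "\<mu> \<noteq> 0" by auto
  then show ?case by (simp add: lookup_one)
next
  case (Cons e es)
  obtain a b where "e = (a, b)" by fastforce
  with Cons show ?case
    by (auto simp: lookup_edge_mult lookup_minus lookup_single)
qed

text \<open>Reversing an edge negates its factor, so all orientations of the same edges give the
  same polynomial up to sign. The induction removes from \<open>D\<close> the single pair lying on
  the first edge.\<close>

lemma graph_poly_orientation:
  assumes "orientation H D" "edges H = upair ` set es"
    and "distinct (map upair es)" "\<forall>e\<in>set es. fst e \<noteq> snd e"
  shows "finite D \<and> (graph_poly D = edge_list_poly es \<or> graph_poly D = - edge_list_poly es)"
  using assms
proof (induction es arbitrary: H D)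
  case Nil
  then have "D = {}" by (auto simp: orientation_def)
  then show ?case by (simp add: graph_poly_def)
next
  case (Cons e es)
  obtain a b where e: "e = (a, b)" by fastforce
  define D' where "D' = D - {(a, b), (b, a)}"
  have ori: "({u, v} = {a, b} \<or> {u, v} \<in> upair ` set es) \<longleftrightarrow> (u, v) \<in> D \<or> (v, u) \<in> D"
    and anti: "(u, v) \<in> D \<Longrightarrow> (v, u) \<notin> D" for u v
    using Cons.prems(1,2) by (auto simp: orientation_def e)
  have new: "{a, b} \<notin> upair ` set es" "a \<noteq> b"
    using Cons.prems by (auto simp: e)
  have "orientation \<lparr>verts = {}, edges = upair ` set es\<rparr> D'"
  proof -
    have "{u, v} \<in> upair ` set es \<longleftrightarrow> (u, v) \<in> D' \<or> (v, u) \<in> D'" for u v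
    proof (cases "{u, v} = {a, b}")
      case True
      with new(1) show ?thesis by (auto simp: D'_def doubleton_eq_iff)
    next
      case False
      with ori[of u v] show ?thesis by (simp add: D'_def) (blast intro: doubleton_eq_iff[THEN iffD2])
    qed
    with anti show ?thesis by (auto simp: orientation_def D'_def)
  qed
  then have IH: "finite D'" "graph_poly D' = edge_list_poly es \<or> graph_poly D' = - edge_list_poly es"
    using Cons.IH[of _ D'] Cons.prems(3,4) by auto
  from ori[of a b] anti consider "(a, b) \<in> D" "(b, a) \<notin> D" | "(b, a) \<in> D" "(a, b) \<notin> D" by blast
  then show ?case
  proof cases
    case 1
    then have "D = insert (a, b) D'" "(a, b) \<notin> D'" by (auto simp: D'_def)
    with IH show ?thesis by (auto simp: graph_poly_def e)
  next
    case 2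
    then have "D = insert (b, a) D'" "(b, a) \<notin> D'" by (auto simp: D'_def)
    with IH show ?thesis by (auto simp: graph_poly_def e algebra_simps)
  qed
qed

section \<open>Fans\<close>

text \<open>The hub \<open>u\<close> is joined to the inner vertices \<open>ys\<close> only, not to
  the ends. An inner vertex \<open>y\<close> brings the factors \<open>(x - y)(u - y)\<close> and
  then starts a shorter fan.\<close>

fun fan :: "'v \<Rightarrow> 'v \<Rightarrow> 'v list \<Rightarrow> 'v \<Rightarrow> ('v \<times> 'v) list" where
  "fan u x [] w = [(x, w)]"
| "fan u x (y # ys) w = (x, y) # (u, y) # fan u y ys w"

lemma path_edges_subset: "e \<in> path_edges xs \<Longrightarrow> e \<subseteq> set xs"
  by (induction xs rule: path_edges.induct) auto

lemma upair_fan: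
  "upair ` set (fan u x ys w) = path_edges (x # ys @ [w]) \<union> (\<lambda>y. {u, y}) ` set ys"
  by (induction u x ys w rule: fan.induct) auto

lemma Union_upair_fan: "\<Union> (upair ` set (fan u x ys w)) \<subseteq> {u, x, w} \<union> set ys"
  by (induction u x ys w rule: fan.induct) auto

lemma fan_not_mem:
  assumes "distinct (u # x # ys @ [w])"
  shows "{u, z} \<in> upair ` set (fan u x ys w) \<longleftrightarrow> z \<in> set ys"
  using assms path_edges_subset[of "{u, z}" "x # ys @ [w]"]
  by (auto simp: upair_fan doubleton_eq_iff)

lemma distinct_fan:
  assumes "distinct (u # x # ys @ [w])"
  shows "distinct (map upair (fan u x ys w))" "\<forall>e\<in>set (fan u x ys w). fst e \<noteq> snd e"
  using assms
proof (induction u x ys w rule: fan.induct)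
  case (2 u x y ys w)
  {
    case 1
    then have "{x, y} \<notin> upair ` set (fan u y ys w)"
      using Union_upair_fan[of u y ys w] by auto
    with 1 2 fan_not_mem[of u y ys w y] show ?case
      by (auto simp: doubleton_eq_iff)
  next
    case 2
    with "2.IH"(2) show ?case by auto
  }
qed auto

section \<open>Coefficients of fans\<close>

abbreviation fan_coeff where
  "fan_coeff u x ys w \<equiv> Poly_Mapping.lookup (edge_list_poly (fan u x ys w))"

text \<open>No edge of the fan meets \<open>x\<close>. This kills terms that leave over a power of a
  vertex already passed on the path.\<close>

lemma fan_coeff_eq_0:
  assumes "x \<notin> insert u (insert y (insert w (set ys)))" "Poly_Mapping.lookup \<mu> x \<noteq> 0"
  shows "fan_coeff u y ys w \<mu> = 0"
  using assms Union_upair_fan[of u y ys w] by (intro lookup_edge_list_poly_eq_0) auto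

text \<open>Exponent 0 at \<open>x\<close> forces \<open>-y\<close> from \<open>(x - y)\<close>; the
  two terms come from taking \<open>-y\<close> or \<open>u\<close> in \<open>(u - y)\<close>. The
  bound 2 leaves the new start \<open>y\<close> with exponent 0 or at most 1, respectively.\<close>

lemma fan_coeff_Cons_0:
  assumes "distinct (u # x # y # ys @ [w])"
    and "Poly_Mapping.lookup \<mu> x = 0" "Poly_Mapping.lookup \<mu> y \<le> 2"
  shows "fan_coeff u x (y # ys) w \<mu> =
    (if Poly_Mapping.lookup \<mu> y = 2
     then fan_coeff u y ys w (\<mu> - Poly_Mapping.single y 2) else 0) -
    (if Poly_Mapping.lookup \<mu> y \<noteq> 0 \<and> Poly_Mapping.lookup \<mu> u \<noteq> 0
     then fan_coeff u y ys w (\<mu> - Poly_Mapping.single y 1 - Poly_Mapping.single u 1) else 0)"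
proof -
  have "\<mu> - Poly_Mapping.single y 1 - Poly_Mapping.single y 1 = \<mu> - Poly_Mapping.single y 2"
    by (rule poly_mapping_eqI) (auto simp: lookup_minus lookup_single when_def)
  then show ?thesis using assms
    by (auto simp: lookup_edge_mult lookup_minus lookup_single when_def)
qed

text \<open>Here \<open>(u - y)\<close> must give \<open>-y\<close>, and \<open>(x - y)\<close> must
  give \<open>x\<close>: the remaining fan does not contain \<open>x\<close> and could not supply
  it.\<close>

lemma fan_coeff_Cons_1:
  assumes "distinct (u # x # y # ys @ [w])"
    and "Poly_Mapping.lookup \<mu> x = 1" "Poly_Mapping.lookup \<mu> u = 0"
  shows "fan_coeff u x (y # ys) w \<mu> =
    (if Poly_Mapping.lookup \<mu> y = 0 then 0
     else - fan_coeff u y ys w (\<mu> - Poly_Mapping.single x 1 - Poly_Mapping.single y 1))"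
proof -
  have "fan_coeff u y ys w (\<mu> - Poly_Mapping.single y 1 - Poly_Mapping.single y 1) = 0"
    using assms by (intro fan_coeff_eq_0[of x]) (auto simp: lookup_minus lookup_single)
  then show ?thesis using assms
    by (auto simp: lookup_edge_mult lookup_minus lookup_single when_def)
qed

text \<open>Both factors at \<open>y\<close> must give \<open>-y\<close>, so \<open>y\<close> needs
  exponent exactly 2 and the shorter fan again starts with exponent 0. In the end only
  \<open>(x - w)\<close> is left, with both exponents 0.\<close>

lemma fan_coeff_hub_0:
  assumes "distinct (u # x # ys @ [w])"
    and "Poly_Mapping.lookup \<mu> x = 0" "Poly_Mapping.lookup \<mu> w = 0" "Poly_Mapping.lookup \<mu> u = 0"
    and "\<forall>y\<in>set ys. Poly_Mapping.lookup \<mu> y \<le> 2"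
  shows "fan_coeff u x ys w \<mu> = 0"
  using assms
proof (induction u x ys w arbitrary: \<mu> rule: fan.induct)
  case (1 u x w)
  then show ?case by (simp add: lookup_edge_mult del: mult_1_right)
next
  case (2 u x y ys w)
  show ?case
  proof (cases "Poly_Mapping.lookup \<mu> y = 2")
    case True
    have "fan_coeff u y ys w (\<mu> - Poly_Mapping.single y 2) = 0"
      by (rule "2.IH") (use 2 True in \<open>auto simp: lookup_minus lookup_single when_def\<close>)
    with 2 show ?thesis by (simp add: fan_coeff_Cons_0 del: fan.simps)
  next
    case False
    with 2 show ?thesis by (simp add: fan_coeff_Cons_0 del: fan.simps)
  qed
qed

text \<open>The single power of \<open>u\<close> has to be taken at some inner vertex. Going two
  vertices at a time, the choices at \<open>y\<close> and at \<open>z\<close> cancel.\<close>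

lemma fan_coeff_hub_1:
  assumes "distinct (u # x # ys @ [w])" "even (length ys)"
    and "Poly_Mapping.lookup \<mu> x = 0" "Poly_Mapping.lookup \<mu> w = 0" "Poly_Mapping.lookup \<mu> u \<le> 1"
    and "\<forall>y\<in>set ys. Poly_Mapping.lookup \<mu> y \<le> 2"
  shows "fan_coeff u x ys w \<mu> = 0"
proof (cases "Poly_Mapping.lookup \<mu> u = 0")
  case True
  with assms show ?thesis by (intro fan_coeff_hub_0) auto
next
  case False
  with assms have "Poly_Mapping.lookup \<mu> u = 1" by simp
  with assms(1-4,6) show ?thesis
  proof (induction ys arbitrary: x \<mu> rule: induct_list012)
    case 1
    then show ?case by (simp add: lookup_edge_mult del: mult_1_right)
  next
    case (3 y z zs)
    define \<nu> where "\<nu> = \<mu> - Poly_Mapping.single y 1 - Poly_Mapping.single u 1"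
    define \<xi> where "\<xi> = \<mu> - Poly_Mapping.single y 2"
    have le: "Poly_Mapping.lookup \<mu> y \<le> 2" "Poly_Mapping.lookup \<mu> z \<le> 2" using 3 by auto
    have step: "fan_coeff u x (y # z # zs) w \<mu> =
      (if Poly_Mapping.lookup \<mu> y = 2 then fan_coeff u y (z # zs) w \<xi> else 0) -
      (if Poly_Mapping.lookup \<mu> y \<noteq> 0 then fan_coeff u y (z # zs) w \<nu> else 0)"
      using 3 by (subst fan_coeff_Cons_0) (auto simp: \<nu>_def \<xi>_def)
    consider "Poly_Mapping.lookup \<mu> y = 0" | "Poly_Mapping.lookup \<mu> y = 1" | "Poly_Mapping.lookup \<mu> y = 2"
      using le by linarith
    then show ?case
    proof cases
      case 1
      with step show ?thesis by simp
    next
      case y: 2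
      \<comment> \<open>With exponent 1, \<open>y\<close> is used up by \<open>(x - y)\<close>, so
        the hub factor gives \<open>u\<close> and a fan with hub exponent 0 remains.\<close>
      have "fan_coeff u y (z # zs) w \<nu> = 0"
        by (rule fan_coeff_hub_0)
          (use 3 y in \<open>auto simp: \<nu>_def lookup_minus lookup_single when_def\<close>)
      with step y show ?thesis by simp
    next
      case y: 3
      \<comment> \<open>The remainder after removing \<open>y^2 z u\<close>. It arises in two ways:
        \<open>u\<close> taken at \<open>y\<close>, with the leftover \<open>y\<close> taken from
        \<open>(y - z)\<close>, or \<open>u\<close> taken at \<open>z\<close>. The signs are such
        that the two contributions cancel.\<close>
      define \<rho> where "\<rho> = \<xi> - Poly_Mapping.single z 1 - Poly_Mapping.single u 1"
      have \<rho>: "\<nu> - Poly_Mapping.single y 1 - Poly_Mapping.single z 1 = \<rho>"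
        by (rule poly_mapping_eqI)
          (auto simp: \<rho>_def \<nu>_def \<xi>_def lookup_minus lookup_single when_def)
      have \<nu>: "fan_coeff u y (z # zs) w \<nu> =
          (if Poly_Mapping.lookup \<mu> z = 0 then 0 else - fan_coeff u z zs w \<rho>)"
        unfolding \<rho>[symmetric] using 3 y le by (subst fan_coeff_Cons_1)
          (auto simp: \<nu>_def lookup_minus lookup_single when_def)
      have \<xi>: "fan_coeff u y (z # zs) w \<xi> =
          (if Poly_Mapping.lookup \<mu> z = 2
           then fan_coeff u z zs w (\<xi> - Poly_Mapping.single z 2) else 0) -
          (if Poly_Mapping.lookup \<mu> z = 0 then 0 else fan_coeff u z zs w \<rho>)"
        using 3 y le by (subst fan_coeff_Cons_0)
          (auto simp: \<rho>_def \<xi>_def lookup_minus lookup_single when_def)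
      have "fan_coeff u z zs w (\<xi> - Poly_Mapping.single z 2) = 0" if "Poly_Mapping.lookup \<mu> z = 2"
        by (rule "3.IH")
          (use 3 y that in \<open>auto simp: \<xi>_def lookup_minus lookup_single when_def\<close>)
      with step y \<nu> \<xi> show ?thesis by simp
    qed
  \<comment> \<open>A single inner vertex is excluded by parity.\<close>
  qed simp
qed

section \<open>Components of a double wheel\<close>

text \<open>\<open>es\<close> lists the edges of a component without its principal edges \<open>{v, w}\<close> and \<open>{v, x}\<close>;
  the former is the edge shared with the other component.\<close>

locale wheel_factor =
  fixes G :: "'v graph" and v x :: 'v and ys :: "'v list" and w :: 'v and es :: "('v \<times> 'v) list"
  assumes distinct_cycle: "distinct (v # x # ys @ [w])"
    and cycle_subset: "set (v # x # ys @ [w]) \<subseteq> verts G"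
    and edges_eq: "edges G = insert {v, w} (insert {v, x} (upair ` set es))"
    and vw_notin: "{v, w} \<notin> upair ` set es"
    and vx_notin: "{v, x} \<notin> upair ` set es"
    and distinct_edges: "distinct (map upair es)"
    and no_loops: "\<forall>e\<in>set es. fst e \<noteq> snd e"
    and edges_subset: "\<Union> (upair ` set es) \<subseteq> verts G"
    and lookup_eq_0: "\<lbrakk>Poly_Mapping.lookup \<mu> v = 0; Poly_Mapping.lookup \<mu> x = 0;
      Poly_Mapping.lookup \<mu> w = 0; \<forall>y\<in>set ys. Poly_Mapping.lookup \<mu> y \<le> 2;
      \<forall>u\<in>verts G - set (v # x # ys @ [w]). Poly_Mapping.lookup \<mu> u \<le> 4\<rbrakk>
      \<Longrightarrow> Poly_Mapping.lookup (edge_list_poly es) \<mu> = 0"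
begin

text \<open>The exponent bounds pass from \<open>\<mu>\<close> to its divisor
  \<open>\<alpha>\<close>, so exponent 0 at \<open>w\<close> would make the coefficient of
  \<open>\<alpha>\<close> vanish.\<close>

lemma lookup_pos:
  assumes "\<alpha> \<in> Poly_Mapping.keys (edge_list_poly es)"
    and le: "\<And>z. Poly_Mapping.lookup \<alpha> z \<le> Poly_Mapping.lookup \<mu> z"
    and "Poly_Mapping.lookup \<mu> v = 0" "Poly_Mapping.lookup \<mu> x = 0"
    and "\<forall>y\<in>set ys. Poly_Mapping.lookup \<mu> y \<le> 2"
    and "\<forall>u\<in>verts G - set (v # x # ys @ [w]). Poly_Mapping.lookup \<mu> u \<le> 4"
  shows "1 \<le> Poly_Mapping.lookup \<alpha> w"
proof (rule ccontr)
  assume "\<not> ?thesis"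
  then have "Poly_Mapping.lookup (edge_list_poly es) \<alpha> = 0"
    using le[of v] le[of x] assms(3,4) order_trans[OF le] assms(5,6)
    by (intro lookup_eq_0) (simp, simp, simp, blast+)
  with assms(1) show False by (simp add: in_keys_iff)
qed

end

text \<open>Without \<open>{v, w}\<close> and \<open>{v, x}\<close>, a broken wheel is the fan with
  hub \<open>v\<close>, which has exponent 0.\<close>

lemma broken_wheel_factor:
  assumes "broken_wheel G (v # x # ys @ [w])"
  shows "wheel_factor G v x ys w (fan v x ys w)"
proof -
  have d: "distinct (v # x # ys @ [w])"
    and G: "verts G = set (v # x # ys @ [w])"
      "edges G = path_edges (x # ys @ [w]) \<union> (\<lambda>z. {v, z}) ` set (x # ys @ [w])"
    using assms by (auto simp: broken_wheel_def)
  show ?thesis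
  proof
    show "edges G = insert {v, w} (insert {v, x} (upair ` set (fan v x ys w)))"
      unfolding G upair_fan by auto
    show "\<Union> (upair ` set (fan v x ys w)) \<subseteq> verts G"
      using Union_upair_fan[of v x ys w] by (auto simp: G)
    show "{v, w} \<notin> upair ` set (fan v x ys w)" "{v, x} \<notin> upair ` set (fan v x ys w)"
      using d unfolding fan_not_mem[OF d] by simp_all
    show "Poly_Mapping.lookup (edge_list_poly (fan v x ys w)) \<mu> = 0"
      if "Poly_Mapping.lookup \<mu> v = 0" "Poly_Mapping.lookup \<mu> x = 0"
        "Poly_Mapping.lookup \<mu> w = 0" "\<forall>y\<in>set ys. Poly_Mapping.lookup \<mu> y \<le> 2" for \<mu>
      using that by (intro fan_coeff_hub_0[OF d])
  qed (use d distinct_fan[OF d] in \<open>simp_all add: G(1)\<close>)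
qed

text \<open>The cycle has three vertices besides \<open>ys\<close>, so odd length of the cycle means
  even length of \<open>ys\<close>, as the fan with hub exponent 1 requires.\<close>

lemma ordinary_wheel_factor:
  assumes "ordinary_wheel G (v # x # ys @ [w])" "odd (length (v # x # ys @ [w]))"
  shows "\<exists>es. wheel_factor G v x ys w es"
proof -
  obtain u where d: "distinct (v # x # ys @ [w])" and u: "u \<notin> set (v # x # ys @ [w])"
    and G: "verts G = insert u (set (v # x # ys @ [w]))"
      "edges G = cycle_edges (v # x # ys @ [w]) \<union> (\<lambda>z. {u, z}) ` set (v # x # ys @ [w])"
    using assms(1) by (auto simp: ordinary_wheel_def)
  define es where "es = (u, v) # (u, x) # (u, w) # fan u x ys w"
  have du: "distinct (u # x # ys @ [w])" and even: "even (length ys)" using d u assms(2) by auto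
  have sub: "\<Union> (upair ` set (fan u x ys w)) \<subseteq> {u, x, w} \<union> set ys"
    by (rule Union_upair_fan)
  then have "v \<notin> \<Union> (upair ` set (fan u x ys w))"
    using d u by auto
  then have new: "{v, z} \<notin> upair ` set (fan u x ys w)" for z
    by blast
  have "wheel_factor G v x ys w es"
  proof
    show "edges G = insert {v, w} (insert {v, x} (upair ` set es))"
      unfolding G es_def by (auto simp: upair_fan cycle_edges_def)
    show "{v, w} \<notin> upair ` set es" "{v, x} \<notin> upair ` set es"
      using new[of w] new[of x] d u by (auto simp: es_def doubleton_eq_iff)
    show "distinct (map upair es)" "\<forall>e\<in>set es. fst e \<noteq> snd e"
      using new[of u] d u fan_not_mem[OF du] distinct_fan[OF du]
      by (auto simp: es_def doubleton_eq_iff insert_commute)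
    show "\<Union> (upair ` set es) \<subseteq> verts G"
      using sub by (auto simp: es_def G)
    show "Poly_Mapping.lookup (edge_list_poly es) \<mu> = 0"
      if \<mu>: "Poly_Mapping.lookup \<mu> v = 0" "Poly_Mapping.lookup \<mu> x = 0" "Poly_Mapping.lookup \<mu> w = 0"
        "\<forall>y\<in>set ys. Poly_Mapping.lookup \<mu> y \<le> 2"
        and "\<forall>u\<in>verts G - set (v # x # ys @ [w]). Poly_Mapping.lookup \<mu> u \<le> 4" for \<mu>
    proof -
      \<comment> \<open>The spokes to \<open>v\<close>, \<open>x\<close>, \<open>w\<close> can only
        contribute \<open>u\<close> each, which leaves at most 4 - 3 = 1 for the fan.\<close>
      let ?\<nu> = "\<mu> - Poly_Mapping.single u 1 - Poly_Mapping.single u 1 - Poly_Mapping.single u 1"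
      have "Poly_Mapping.lookup \<mu> u \<le> 4" using that u by (simp add: G(1))
      then have "fan_coeff u x ys w ?\<nu> = 0"
        using \<mu> u by (intro fan_coeff_hub_1[OF du even])
          (auto simp: lookup_minus lookup_single when_def)
      with \<mu> u show ?thesis
        by (auto simp: es_def lookup_edge_mult lookup_minus lookup_single when_def)
    qed
  qed (use d in \<open>auto simp: G(1)\<close>)
  then show ?thesis by blast
qed

lemma component_factor:
  assumes "ordinary_wheel G (v # xs @ [w]) \<or> broken_wheel G (v # xs @ [w])" "\<not> even_wheel G"
  obtains x ys es where "xs = x # ys" "wheel_factor G v x ys w es"
proof -
  have "xs \<noteq> []"
    using assms(1) by (auto simp: ordinary_wheel_def broken_wheel_def)
  then obtain x ys where xs: "xs = x # ys" by (cases xs) auto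
  have "\<exists>es. wheel_factor G v x ys w es"
  proof (cases "ordinary_wheel G (v # xs @ [w])")
    case True
    with assms(2) have "odd (length (v # xs @ [w]))" by (auto simp: even_wheel_def)
    with True show ?thesis using ordinary_wheel_factor by (metis append_Cons xs)
  next
    case False
    with assms(1) show ?thesis using broken_wheel_factor by (metis append_Cons xs)
  qed
  with xs that show ?thesis by auto
qed

section \<open>Gluing the two components\<close>

theorem theorem5p9:
  fixes G G1 G2 :: "'v graph"
    and vs :: "'v list"
    and D :: "('v \<times> 'v) set"
    and \<mu> :: "'v monomial"
  assumes "double_wheel G G1 G2 vs"
    and "\<not> even_wheel G1"
    and "\<not> even_wheel G2"
    and "orientation (delete_edges G (principal_edges vs)) D"
    and "Poly_Mapping.keys \<mu> \<subseteq> verts G"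
    and "\<forall>x \<in> {hd vs, vs ! 1, last vs}. Poly_Mapping.lookup \<mu> x = 0"
    and "\<forall>x \<in> set vs - {hd vs, vs ! 1, last vs}. Poly_Mapping.lookup \<mu> x \<le> 2"
    and "\<forall>x \<in> verts G - set vs. Poly_Mapping.lookup \<mu> x \<le> 4"
  shows "vanishes_in \<mu> (graph_poly D)"
proof (rule ccontr)
  assume nonzero: "\<not> vanishes_in \<mu> (graph_poly D)"
  obtain v xs w ys where vs: "vs = v # xs @ w # ys"
    and W1: "ordinary_wheel G1 (v # xs @ [w]) \<or> broken_wheel G1 (v # xs @ [w])"
    and W2: "ordinary_wheel G2 (v # w # ys) \<or> broken_wheel G2 (v # w # ys)"
    and meet: "verts G1 \<inter> verts G2 = {v, w}" and G: "G = graph_union G1 G2"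
    using assms(1) unfolding double_wheel_def by blast
  \<comment> \<open>Reflecting the second component puts the shared vertex \<open>w\<close> last in
    both cycles.\<close>
  have W2': "ordinary_wheel G2 (v # rev ys @ [w]) \<or> broken_wheel G2 (v # rev ys @ [w])"
    using W2 ordinary_wheel_reflect[of G2 v "w # ys"] broken_wheel_reflect[of G2 v "w # ys"] by auto
  obtain x1 ys1 es1 where xs: "xs = x1 # ys1" and "wheel_factor G1 v x1 ys1 w es1"
    using component_factor[OF W1 assms(2)] by metis
  then interpret F1: wheel_factor G1 v x1 ys1 w es1 by simp
  obtain x2 ys2 es2 where "rev ys = x2 # ys2" and "wheel_factor G2 v x2 ys2 w es2"
    using component_factor[OF W2' assms(3)] by metis
  then interpret F2: wheel_factor G2 v x2 ys2 w es2 by simp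
  have ys: "ys = rev ys2 @ [x2]"
    using \<open>rev ys = x2 # ys2\<close> by (metis rev.simps(2) rev_rev_ident)
  have principal: "principal_edges vs = {{v, x1}, {v, x2}}"
    by (auto simp: principal_edges_def vs xs ys insert_commute)
  have apart: "x1 \<notin> verts G2" "x2 \<notin> verts G1" "set ys1 \<inter> verts G2 = {}" "set ys2 \<inter> verts G1 = {}"
    using F1.distinct_cycle F1.cycle_subset F2.distinct_cycle F2.cycle_subset meet by auto
  define es where "es = (w, v) # es1 @ es2"
  \<comment> \<open>A common edge would have both ends in \<open>{v, w}\<close>, but the edge
    \<open>{v, w}\<close> is in neither list.\<close>
  have disj: "upair ` set es1 \<inter> upair ` set es2 = {}"
  proof (rule ccontr)
    assume "\<not> ?thesis"
    then obtain e where e: "e \<in> upair ` set es1" "e \<in> upair ` set es2" by blast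
    then have "e \<subseteq> {v, w}" using F1.edges_subset F2.edges_subset meet by blast
    moreover have "card e = 2" using e(1) F1.no_loops by auto
    ultimately have "e = {v, w}" using F1.distinct_cycle by (intro card_subset_eq) auto
    with e F1.vw_notin show False by blast
  qed
  have ends: "hd vs = v" "vs ! 1 = x1" "last vs = x2"
    by (auto simp: vs xs ys)
  have inner: "y \<noteq> x1" "y \<noteq> x2" "y \<noteq> v" if "y \<in> set ys1 \<union> set ys2 \<union> {w}" for y
    using that F1.distinct_cycle F1.cycle_subset F2.distinct_cycle F2.cycle_subset apart by auto
  have "distinct (map upair es)"
    using F1.distinct_edges F2.distinct_edges F1.vw_notin F2.vw_notin disj
    by (simp add: es_def insert_commute)
  moreover have "\<forall>e\<in>set es. fst e \<noteq> snd e"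
    using F1.no_loops F2.no_loops F1.distinct_cycle by (auto simp: es_def)
  moreover have "edges (delete_edges G (principal_edges vs)) = upair ` set es"
  proof -
    \<comment> \<open>Here \<open>p\<close> stands for the shared edge and \<open>q1\<close>,
      \<open>q2\<close> for the two principal edges of the double wheel.\<close>
    have remove: "insert p (insert q1 A1) \<union> insert p (insert q2 A2) - {q1, q2} = insert p (A1 \<union> A2)"
      if "q1 \<notin> A1" "q2 \<notin> A1" "q1 \<notin> A2" "q2 \<notin> A2" "p \<noteq> q1" "p \<noteq> q2"
      for p q1 q2 :: "'v set" and A1 A2
      using that by blast
    have "{v, x1} \<notin> upair ` set es2" "{v, x2} \<notin> upair ` set es1"
      using F1.edges_subset F2.edges_subset apart by blast+
    moreover have "{v, w} \<noteq> {v, x1}" "{v, w} \<noteq> {v, x2}"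
      using inner[of w] by (auto simp: doubleton_eq_iff)
    moreover have "upair ` set es = insert {v, w} (upair ` set es1 \<union> upair ` set es2)"
      by (auto simp: es_def)
    ultimately show ?thesis
      using remove[OF F1.vx_notin _ _ F2.vx_notin]
      by (simp add: delete_edges_def principal G graph_union_def F1.edges_eq F2.edges_eq)
  qed
  ultimately have "graph_poly D = edge_list_poly es \<or> graph_poly D = - edge_list_poly es"
    using graph_poly_orientation[OF assms(4)] by blast
  with nonzero have "\<mu> \<in> Poly_Mapping.keys ((Var w - Var v) * (edge_list_poly es1 * edge_list_poly es2))"
    by (auto simp: vanishes_in_def es_def edge_list_poly_append in_keys_iff)
  moreover have \<mu>: "Poly_Mapping.lookup \<mu> v = 0" "Poly_Mapping.lookup \<mu> x1 = 0"
    "Poly_Mapping.lookup \<mu> x2 = 0" "Poly_Mapping.lookup \<mu> w \<le> 2"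
    "\<forall>y\<in>set ys1. Poly_Mapping.lookup \<mu> y \<le> 2" "\<forall>y\<in>set ys2. Poly_Mapping.lookup \<mu> y \<le> 2"
    "\<forall>u\<in>verts G1 - set (v # x1 # ys1 @ [w]). Poly_Mapping.lookup \<mu> u \<le> 4"
    "\<forall>u\<in>verts G2 - set (v # x2 # ys2 @ [w]). Poly_Mapping.lookup \<mu> u \<le> 4"
  proof -
    have set_vs: "set vs = {v, x1, x2, w} \<union> set ys1 \<union> set ys2"
      by (auto simp: vs xs ys)
    have outer: "Poly_Mapping.lookup \<mu> y \<le> 2" if "y \<in> set ys1 \<union> set ys2 \<union> {w}" for y
      using assms(7) inner[OF that] that unfolding ends set_vs by blast
    have hub: "Poly_Mapping.lookup \<mu> u \<le> 4" if "u \<in> verts G1 \<union> verts G2 - set vs" for u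
      using assms(8) that by (simp add: G graph_union_def)
    have "verts G1 - set (v # x1 # ys1 @ [w]) \<subseteq> verts G1 \<union> verts G2 - set vs"
      "verts G2 - set (v # x2 # ys2 @ [w]) \<subseteq> verts G1 \<union> verts G2 - set vs"
      using apart by (auto simp: set_vs)
    with assms(6) outer hub show
      "Poly_Mapping.lookup \<mu> v = 0" "Poly_Mapping.lookup \<mu> x1 = 0"
      "Poly_Mapping.lookup \<mu> x2 = 0" "Poly_Mapping.lookup \<mu> w \<le> 2"
      "\<forall>y\<in>set ys1. Poly_Mapping.lookup \<mu> y \<le> 2" "\<forall>y\<in>set ys2. Poly_Mapping.lookup \<mu> y \<le> 2"
      "\<forall>u\<in>verts G1 - set (v # x1 # ys1 @ [w]). Poly_Mapping.lookup \<mu> u \<le> 4"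
      "\<forall>u\<in>verts G2 - set (v # x2 # ys2 @ [w]). Poly_Mapping.lookup \<mu> u \<le> 4"
      unfolding ends by blast+
  qed
  \<comment> \<open>As \<open>v\<close> has exponent 0, the factor \<open>Var w - Var v\<close>
    supplies \<open>w\<close>, and the rest splits into a monomial from each component.\<close>
  ultimately obtain \<alpha> \<beta> where wpos: "Poly_Mapping.lookup \<mu> w \<noteq> 0"
    and split: "\<mu> - Poly_Mapping.single w 1 = \<alpha> + \<beta>"
    and \<alpha>: "\<alpha> \<in> Poly_Mapping.keys (edge_list_poly es1)"
    and \<beta>: "\<beta> \<in> Poly_Mapping.keys (edge_list_poly es2)"
    using keys_mult[of "edge_list_poly es1" "edge_list_poly es2"]
    by (auto simp: in_keys_iff lookup_edge_mult split: if_splits)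
  have sum: "Poly_Mapping.lookup \<alpha> z + Poly_Mapping.lookup \<beta> z =
      Poly_Mapping.lookup \<mu> z - (if z = w then 1 else 0)" for z
    by (simp add: lookup_minus lookup_single when_def flip: lookup_add split)
  have "Poly_Mapping.lookup \<alpha> z \<le> Poly_Mapping.lookup \<mu> z"
    "Poly_Mapping.lookup \<beta> z \<le> Poly_Mapping.lookup \<mu> z" for z
    using sum[of z] by linarith+
  then have "1 \<le> Poly_Mapping.lookup \<alpha> w" "1 \<le> Poly_Mapping.lookup \<beta> w"
    using F1.lookup_pos[OF \<alpha>] F2.lookup_pos[OF \<beta>] \<mu> by blast+
  \<comment> \<open>The shared edge and the two components each use a \<open>w\<close>, three in
    all, against the bound 2.\<close>
  with sum[of w] wpos \<mu>(4) show False by simp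
qed

end
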